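(* Let $D$ be an acyclic multidigraph that contains no alternating closed trail. Then the directed linear forest complex $\mathrm{Dlf}(D)$ is vertex decomposable.
   Context: A multidigraph $D$ consists of finite sets $V(D)$ (vertices) and $E(D)$ (edges) together with maps $s,t:E(D)\to V(D)$ (source and target). For $\sigma\subseteq E(D)$, $D[\sigma]$ denotes the multidigraph with edge set $\sigma$ and vertex set the endpoints of edges in $\sigma$. A directed cycle is a connected digraph (multidigraph without parallel edges, i.e. no two distinct edges with the same source and the same target) in which every vertex has in-degree and out-degree equal to $1$; a directed path is obtained from a directed cycle by removing exactly one edge. $D$ is acyclic if it contains no directed cycle (as a subgraph). An alternating closed trail in $D$ is a cyclic sequence of distinct edges $e_0,e_1,\dots,e_{k-1},e_0$ of $D$ such that for every $i$ (indices modulo $k$), $s(e_i)=s(e_{i+1})$ or $t(e_i)=t(e_{i+1})$. The directed linear forest complex $\mathrm{Dlf}(D)$ is the simplicial complex on vertex set $E(D)$ whose faces are the subsets $\sigma\subseteq E(D)$ such that $D[\sigma]$ is a vertex-disjoint union of directed paths. A simplicial complex $\Delta$ is vertex decomposable if either $\Delta$ is a simplex (including the void complex and $\{\emptyset\}$), or there is a vertex $v$ such that $\mathrm{lk}_\Delta(v)=\{\tau\in\Delta: v\notin\tau,\ \tau\cup\{v\}\in\Delta\}$ and $\mathrm{del}_\Delta(v)=\{\tau\in\Delta: v\notin\tau\}$ are both vertex decomposable and every facet of $\mathrm{del}_\Delta(v)$ is a facet of $\Delta$. *)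

theory Defs
  imports "Graph_Theory.Graph_Theory"
begin

text \<open>
  A multidigraph is a \<open>fin_digraph\<close>: finite sets of vertices and arcs, with source map \<open>tail\<close> and
  target map \<open>head\<close>; loops and parallel arcs are allowed.
\<close>

section \<open>Directed cycles and directed paths\<close>

text \<open>Loops are allowed here, so a single vertex with a loop is a directed cycle.\<close>

definition directed_cycle :: "('a, 'b) pre_digraph \<Rightarrow> bool" where
  "directed_cycle C \<longleftrightarrow> fin_digraph C \<and> nomulti_digraph C \<and> connected C \<and>
     (\<forall>v\<in>verts C. in_degree C v = 1 \<and> out_degree C v = 1)"

text \<open>
  The arc that is removed need not exist in the arc type \<open>'b\<close> of \<open>P\<close> (think of a one-element type
  \<open>'b\<close>). The cycle is therefore taken over the natural numbers, where every finite digraph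
  has a copy, and \<open>P\<close> is compared with the result up to isomorphism.
\<close>

definition directed_path :: "('a, 'b) pre_digraph \<Rightarrow> bool" where
  "directed_path P \<longleftrightarrow> (\<exists>(C :: (nat, nat) pre_digraph) a.
     directed_cycle C \<and> a \<in> arcs C \<and> digraph_iso (pre_digraph.del_arc C a) P)"

definition acyclic_digraph :: "('a, 'b) pre_digraph \<Rightarrow> bool" where
  "acyclic_digraph D \<longleftrightarrow> \<not> (\<exists>C. subgraph C D \<and> directed_cycle C)"

section \<open>Alternating closed trails\<close>

text \<open>
  Consecutive arcs (cyclically) share their source or share their target. That the trail is
  alternating means that the two kinds of coincidence alternate: \<open>c i\<close> tells whether arcs \<open>i\<close> and
  \<open>i + 1\<close> meet at a common source or at a common target, so each arc is traversed from one of its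
  ends to the other. Without this, a single arc, or any set of arcs with the same source, would
  form an alternating closed trail. The length is necessarily even; two parallel arcs form a trail
  of length 2.
\<close>

definition alternating_closed_trail :: "('a, 'b) pre_digraph \<Rightarrow> 'b list \<Rightarrow> bool" where
  "alternating_closed_trail D es \<longleftrightarrow> es \<noteq> [] \<and> distinct es \<and> set es \<subseteq> arcs D \<and>
     (\<exists>c :: nat \<Rightarrow> bool. \<forall>i<length es. let j = Suc i mod length es in
        c j \<noteq> c i \<and>
        (if c i then tail D (es ! i) = tail D (es ! j)
         else head D (es ! i) = head D (es ! j)))"

lemma alternating_closed_trail_consecutive:
  assumes "alternating_closed_trail D es" and "i < length es"
  shows "tail D (es ! i) = tail D (es ! (Suc i mod length es)) \<or>
         head D (es ! i) = head D (es ! (Suc i mod length es))"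
  using assms unfolding alternating_closed_trail_def Let_def by metis

section \<open>Simplicial complexes\<close>

text \<open>The void complex \<open>{}\<close> and the complex \<open>{{}}\<close> are both included.\<close>

definition simplicial_complex :: "'v set set \<Rightarrow> bool" where
  "simplicial_complex \<Delta> \<longleftrightarrow> finite (\<Union>\<Delta>) \<and> (\<forall>\<sigma>\<in>\<Delta>. \<forall>\<tau>\<subseteq>\<sigma>. \<tau> \<in> \<Delta>)"

definition facets :: "'v set set \<Rightarrow> 'v set set" where
  "facets \<Delta> = {\<sigma>\<in>\<Delta>. \<forall>\<tau>\<in>\<Delta>. \<sigma> \<subseteq> \<tau> \<longrightarrow> \<tau> = \<sigma>}"

definition link :: "'v set set \<Rightarrow> 'v \<Rightarrow> 'v set set" where
  "link \<Delta> v = {\<tau>\<in>\<Delta>. v \<notin> \<tau> \<and> insert v \<tau> \<in> \<Delta>}"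

definition deletion :: "'v set set \<Rightarrow> 'v \<Rightarrow> 'v set set" where
  "deletion \<Delta> v = {\<tau>\<in>\<Delta>. v \<notin> \<tau>}"

inductive vertex_decomposable :: "'v set set \<Rightarrow> bool" where
  void: "vertex_decomposable {}"
| simplex: "finite \<sigma> \<Longrightarrow> vertex_decomposable (Pow \<sigma>)"
| shed: "\<lbrakk>simplicial_complex \<Delta>; {v} \<in> \<Delta>;
          vertex_decomposable (link \<Delta> v); vertex_decomposable (deletion \<Delta> v);
          facets (deletion \<Delta> v) \<subseteq> facets \<Delta>\<rbrakk> \<Longrightarrow> vertex_decomposable \<Delta>"

section \<open>The directed linear forest complex\<close>

definition arc_subgraph :: "('a, 'b) pre_digraph \<Rightarrow> 'b set \<Rightarrow> ('a, 'b) pre_digraph" where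
  "arc_subgraph D \<sigma> =
     \<lparr>verts = tail D ` \<sigma> \<union> head D ` \<sigma>, arcs = \<sigma>, tail = tail D, head = head D\<rparr>"

text \<open>\<open>\<P>\<close> may be empty, so the empty digraph is a directed linear forest.\<close>

definition directed_linear_forest :: "('a, 'b) pre_digraph \<Rightarrow> bool" where
  "directed_linear_forest H \<longleftrightarrow> (\<exists>\<P>. (\<forall>P\<in>\<P>. directed_path P \<and> compatible H P) \<and>
     pairwise (\<lambda>P Q. verts P \<inter> verts Q = {}) \<P> \<and> pre_digraph.Union H \<P> = H)"

definition Dlf :: "('a, 'b) pre_digraph \<Rightarrow> 'b set set" where
  "Dlf D = {\<sigma>. \<sigma> \<subseteq> arcs D \<and> directed_linear_forest (arc_subgraph D \<sigma>)}"

end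

theory Submission
  imports Defs
begin

text \<open>
  In an acyclic multidigraph a set of arcs is a directed linear forest as soon as no two of its
  arcs share a source and no two share a target. Splitting every vertex into an out-copy and an
  in-copy therefore turns \<open>Dlf D\<close> into the matching complex of a bipartite graph, whose cycles
  are the alternating closed trails of \<open>D\<close>, so the graph is a forest. Unless its edges are
  pairwise disjoint (and the complex is a simplex), it has an edge \<open>e\<close> with a leaf at one end
  and another edge \<open>f\<close> at the other end. Then \<open>f\<close> can be shed: a matching that avoids \<open>f\<close> and
  is maximal as such must meet the non-leaf end of \<open>e\<close>, which blocks \<open>f\<close>. Link and deletion of
  \<open>f\<close> are matching complexes of smaller forests.
\<close>

section \<open>Matching complexes\<close>

text \<open>Arcs are edges of a bipartite graph whose ends \<open>s e\<close> and \<open>t e\<close>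
  lie on separate sides: \<open>s e = t f\<close> is no incidence. Keeping \<open>s\<close> and
  \<open>t\<close> abstract allows the two sides to be swapped.\<close>

definition matchings :: "('b \<Rightarrow> 'a) \<Rightarrow> ('b \<Rightarrow> 'c) \<Rightarrow> 'b set \<Rightarrow> 'b set set" where
  "matchings s t E = {\<sigma>. \<sigma> \<subseteq> E \<and> inj_on s \<sigma> \<and> inj_on t \<sigma>}"

lemma matchings_commute: "matchings s t E = matchings t s E"
  by (auto simp: matchings_def)

lemma simplicial_complex_matchings:
  assumes "finite E" shows "simplicial_complex (matchings s t E)"
proof -
  have "\<Union>(matchings s t E) \<subseteq> E" by (auto simp: matchings_def)
  then have "finite (\<Union>(matchings s t E))" using assms by (rule finite_subset)
  then show ?thesis
    by (auto simp: simplicial_complex_def matchings_def intro: inj_on_subset)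
qed

lemma deletion_matchings: "deletion (matchings s t E) f = matchings s t (E - {f})"
  by (auto simp: deletion_def matchings_def)

text \<open>The condition also removes \<open>f\<close> itself, so the link is the matching complex
  of a proper subset of \<open>E\<close>, within reach of an induction on the number of
  arcs.\<close>

lemma link_matchings:
  assumes "f \<in> E"
  shows "link (matchings s t E) f = matchings s t {g\<in>E. s g \<noteq> s f \<and> t g \<noteq> t f}"
proof -
  have inj_s: "inj_on s (insert f \<tau>) \<longleftrightarrow> inj_on s \<tau> \<and> (\<forall>g\<in>\<tau>. s g \<noteq> s f)" if "f \<notin> \<tau>" for \<tau>
    using that by (auto simp: inj_on_insert image_iff)
  have inj_t: "inj_on t (insert f \<tau>) \<longleftrightarrow> inj_on t \<tau> \<and> (\<forall>g\<in>\<tau>. t g \<noteq> t f)" if "f \<notin> \<tau>" for \<tau>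
    using that by (auto simp: inj_on_insert image_iff)
  show ?thesis
  proof (rule set_eqI)
    fix \<tau>
    show "\<tau> \<in> link (matchings s t E) f \<longleftrightarrow> \<tau> \<in> matchings s t {g\<in>E. s g \<noteq> s f \<and> t g \<noteq> t f}"
    proof (cases "f \<in> \<tau>")
      case True
      then show ?thesis unfolding link_def matchings_def by blast
    next
      case False
      then show ?thesis
        using assms unfolding link_def matchings_def mem_Collect_eq inj_s[OF False] inj_t[OF False]
        by blast
    qed
  qed
qed

text \<open>The edge \<open>e\<close> competes with \<open>f\<close> at the \<open>s\<close>-end and
  is a leaf at the \<open>t\<close>-end. If a facet \<open>M\<close> of the deletion could grow by
  \<open>f\<close>, no edge of \<open>M\<close> would meet that \<open>s\<close>-end, and
  \<open>e\<close> could be added instead.\<close>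

lemma facets_deletion_matchings:
  assumes "e \<in> E" "f \<in> E" "e \<noteq> f" "s f = s e" and leaf: "\<And>g. g \<in> E \<Longrightarrow> t g = t e \<Longrightarrow> g = e"
  shows "facets (deletion (matchings s t E) f) \<subseteq> facets (matchings s t E)"
proof
  fix M assume "M \<in> facets (deletion (matchings s t E) f)"
  then have M: "M \<in> matchings s t (E - {f})"
    and max: "\<And>\<tau>. \<tau> \<in> matchings s t (E - {f}) \<Longrightarrow> M \<subseteq> \<tau> \<Longrightarrow> \<tau> = M"
    by (auto simp: facets_def deletion_matchings)
  have "\<tau> = M" if \<tau>: "\<tau> \<in> matchings s t E" and sub: "M \<subseteq> \<tau>" for \<tau>
  proof (cases "f \<in> \<tau>")
    case False
    then have "\<tau> \<in> matchings s t (E - {f})" using \<tau> by (auto simp: matchings_def)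
    then show ?thesis using max sub by blast
  next
    case True
    have "s g \<noteq> s e" if "g \<in> M" for g
    proof
      assume "s g = s e"
      then have "s g = s f" using assms(4) by simp
      moreover have "inj_on s \<tau>" "g \<in> \<tau>" using \<tau> sub that by (auto simp: matchings_def)
      ultimately have "g = f" using True by (meson inj_onD)
      then show False using M that by (auto simp: matchings_def)
    qed
    moreover have "t g \<noteq> t e" if "g \<in> M" "g \<noteq> e" for g
      using leaf[of g] M that by (auto simp: matchings_def)
    ultimately have "insert e M \<in> matchings s t (E - {f})"
      using M assms(1,3) by (fastforce simp: matchings_def)
    \<comment> \<open>Maximality puts \<open>e\<close> into \<open>M\<close>, although no edge of
      \<open>M\<close> has the \<open>s\<close>-end of \<open>e\<close>: this case is
      contradictory.\<close>
    then have "e \<in> M" using max by blast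
    then show ?thesis using \<open>\<And>g. g \<in> M \<Longrightarrow> s g \<noteq> s e\<close> by blast
  qed
  moreover have "M \<in> matchings s t E" using M by (auto simp: matchings_def)
  ultimately show "M \<in> facets (matchings s t E)" by (auto simp: facets_def)
qed

section \<open>Leaves\<close>

text \<open>Pigeonhole with \<open>j\<close> chosen least: all entries before \<open>j\<close> are
  distinct, so the segment from \<open>i\<close> to \<open>j - 1\<close> can serve as a closed trail
  or a directed cycle.\<close>

lemma first_repetition:
  fixes e :: "nat \<Rightarrow> 'b"
  assumes "finite A" "\<And>n. e n \<in> A"
  obtains i j where "i < j" "e i = e j" "inj_on e {..<j}"
proof -
  have "\<not> inj e" using assms finite_subset[of "range e" A] finite_imageD[of e UNIV] by auto
  then obtain a b where "a \<noteq> b" "e a = e b" by (auto simp: inj_on_def)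
  then have "\<exists>n. \<not> inj_on e {..n}"
    by (intro exI[of _ "max a b"]) (meson inj_onD atMost_iff max.cobounded1 max.cobounded2)
  define j where "j = (LEAST n. \<not> inj_on e {..n})"
  have j: "\<not> inj_on e {..j}" unfolding j_def using \<open>\<exists>n. _ n\<close> by (rule LeastI_ex)
  have inj: "inj_on e {..<j}"
  proof (rule inj_onI)
    fix x y assume "x \<in> {..<j}" "y \<in> {..<j}" and eq: "e x = e y"
    then have "max x y < j" by auto
    then have "inj_on e {..max x y}" unfolding j_def using not_less_Least by blast
    then show "x = y" using eq by (auto dest: inj_onD)
  qed
  have "{..j} = insert j {..<j}" by auto
  then have "e j \<in> e ` {..<j}" using j inj by auto
  then obtain i where "i < j" "e i = e j" by auto
  with inj show ?thesis using that by blast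
qed

text \<open>The parity of the position in \<open>e\<close> serves as the alternation pattern. The
  even length \<open>b - a\<close> keeps it alternating at the wraparound from \<open>b - 1\<close>
  to \<open>a\<close>.\<close>

lemma alternating_closed_trail_map_upt:
  assumes "a < b" "even (b - a)" "inj_on e {a..<b}" "e ` {a..<b} \<subseteq> arcs D"
    and step: "\<And>i. a \<le> i \<Longrightarrow> Suc i < b \<Longrightarrow>
       if even i then tail D (e i) = tail D (e (Suc i)) else head D (e i) = head D (e (Suc i))"
    and close: "if even (b - 1) then tail D (e (b - 1)) = tail D (e a)
       else head D (e (b - 1)) = head D (e a)"
  shows "alternating_closed_trail D (map e [a..<b])"
  unfolding alternating_closed_trail_def
proof (intro conjI exI[of _ "\<lambda>i. even (a + i)"] allI impI)
  show "map e [a..<b] \<noteq> []" "distinct (map e [a..<b])" "set (map e [a..<b]) \<subseteq> arcs D"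
    using assms(1,3,4) by (auto simp: distinct_map)
  fix i assume i: "i < length (map e [a..<b])"
  show "let j = Suc i mod length (map e [a..<b]) in
          even (a + j) \<noteq> even (a + i) \<and>
          (if even (a + i) then tail D (map e [a..<b] ! i) = tail D (map e [a..<b] ! j)
           else head D (map e [a..<b] ! i) = head D (map e [a..<b] ! j))"
  proof (cases "Suc i = b - a")
    case True
    then have b: "b = Suc (a + i)" using assms(1) by simp
    moreover have "odd i" using True assms(2) by (metis even_Suc)
    ultimately show ?thesis using close by (auto simp: Let_def simp del: upt_Suc)
  next
    case False
    then have "Suc i mod (b - a) = Suc i" "a + Suc i < b" using i by auto
    then show ?thesis using step[of "a + i"] i by (auto simp: Let_def)
  qed
qed

text \<open>Without such a leaf, an arc that meets another arc at one end also meets one at its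
  other end. An alternating walk then never gets stuck, and its first repetition yields an
  alternating closed trail inside \<open>E\<close>.\<close>

lemma ex_leaf_arc:
  assumes "finite E" "E \<subseteq> arcs D" and noact: "\<nexists>es. set es \<subseteq> E \<and> alternating_closed_trail D es"
    and noninj: "\<not> (inj_on (tail D) E \<and> inj_on (head D) E)"
  obtains e f where "e \<in> E" "f \<in> E" "e \<noteq> f" "tail D f = tail D e"
      "\<And>g. g \<in> E \<Longrightarrow> head D g = head D e \<Longrightarrow> g = e"
    | e f where "e \<in> E" "f \<in> E" "e \<noteq> f" "head D f = head D e"
      "\<And>g. g \<in> E \<Longrightarrow> tail D g = tail D e \<Longrightarrow> g = e"
proof (rule ccontr)
  note leaf = that
  assume "\<not> thesis"
  have th: "\<exists>g\<in>E. head D g = head D e \<and> g \<noteq> e"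
      if "e \<in> E" "f \<in> E" "e \<noteq> f" "tail D f = tail D e" for e f
    using leaf(1)[OF that] \<open>\<not> thesis\<close> by blast
  have ht: "\<exists>g\<in>E. tail D g = tail D e \<and> g \<noteq> e"
      if "e \<in> E" "f \<in> E" "e \<noteq> f" "head D f = head D e" for e f
    using leaf(2)[OF that] \<open>\<not> thesis\<close> by blast
  \<comment> \<open>By \<open>th\<close>, the arcs of \<open>A\<close> also share their head with
    another arc, so a walk can go on from either end; \<open>ht\<close> keeps it in
    \<open>A\<close>.\<close>
  define A where "A = {e\<in>E. \<exists>g\<in>E. g \<noteq> e \<and> tail D g = tail D e}"
  \<comment> \<open>\<open>p n\<close> is the end at which the arcs \<open>n\<close> and
    \<open>n + 1\<close> of the walk will meet.\<close>
  define p where "p i = (if even i then tail D else head D)" for i :: nat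
  have "\<exists>x. x \<in> A"
    using noninj ht unfolding inj_on_def A_def by (smt (verit) mem_Collect_eq)
  moreover have "\<exists>y. y \<in> A \<and> y \<noteq> x \<and> p n y = p n x" if "x \<in> A" for x n
  proof (cases "even n")
    case True
    then show ?thesis using that by (force simp: A_def p_def)
  next
    case False
    obtain g where g: "g \<in> E" "head D g = head D x" "g \<noteq> x"
      using th \<open>x \<in> A\<close> by (force simp: A_def)
    then have "g \<in> A" using ht[of g x] \<open>x \<in> A\<close> by (auto simp: A_def)
    with g False show ?thesis by (auto simp: p_def)
  qed
  ultimately obtain e where e: "\<And>n. e n \<in> A"
      and step: "\<And>n. e (Suc n) \<noteq> e n" "\<And>n. p n (e (Suc n)) = p n (e n)"
    using dependent_nat_choice[of "\<lambda>_ x. x \<in> A" "\<lambda>n x y. y \<noteq> x \<and> p n y = p n x"] by metis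
  have "finite A" using \<open>finite E\<close> by (simp add: A_def)
  then obtain i j where ij: "i < j" "e i = e j" and inj: "inj_on e {..<j}"
    using first_repetition e by metis
  have p_step: "if even n then tail D (e n) = tail D (e (Suc n)) else head D (e n) = head D (e (Suc n))" for n
    using step(2)[of n] by (auto simp: p_def)
  \<comment> \<open>The closed trail starts at \<open>a = i\<close> or, after one arc is dropped, at
    \<open>a = Suc i\<close>.\<close>
  have trail: False if "i \<le> a" "a < j" "even (j - a)" "p (j - 1) (e (j - 1)) = p (j - 1) (e a)" for a
  proof -
    have "e ` {a..<j} \<subseteq> E" using e by (auto simp: A_def)
    moreover have "inj_on e {a..<j}" using inj by (rule inj_on_subset) auto
    moreover have "if even (j - 1) then tail D (e (j - 1)) = tail D (e a)
        else head D (e (j - 1)) = head D (e a)"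
      using that(4) by (cases "even (j - 1)") (simp_all only: p_def if_True if_False simp_thms)
    ultimately have "alternating_closed_trail D (map e [a..<j])"
      using that(2,3) \<open>E \<subseteq> arcs D\<close>
      by (intro alternating_closed_trail_map_upt p_step) (assumption | blast)+
    then show False using noact \<open>e ` {a..<j} \<subseteq> E\<close> by (metis list.set_map set_upt)
  qed
  \<comment> \<open>As \<open>e j = e i\<close>, the arcs at positions \<open>j - 1\<close> and
    \<open>i\<close> meet at the end \<open>p (j - 1)\<close>.\<close>
  have close: "p (j - 1) (e (j - 1)) = p (j - 1) (e i)"
    using step(2)[of "j - 1"] ij by (metis Suc_diff_1 gr_implies_not0 gr0I)
  show False
  proof (cases "even (j - i)")
    case True
    then show False using trail[of i] ij close by blast
  next
    \<comment> \<open>The walk returns to \<open>e i\<close> at the end where it left it, so that arc is skipped.\<close>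
    case False
    then have "p (j - 1) = p i" using ij by (auto simp: p_def)
    \<comment> \<open>Consecutive arcs differ, so the odd number \<open>j - i\<close> is at least 3
      and the shortened trail is nonempty.\<close>
    moreover have "Suc i \<noteq> j" using step(1)[of i] ij by auto
    ultimately have "p (j - 1) (e (j - 1)) = p (j - 1) (e (Suc i))" "Suc i < j"
      using close step(2)[of i] ij by simp_all
    then show False using trail[of "Suc i"] False by simp
  qed
qed

section \<open>Vertex decomposability of matching complexes of forests\<close>

text \<open>Forbidding trails inside \<open>E\<close>, with \<open>D\<close> fixed, makes the
  hypotheses pass to subsets of \<open>E\<close>, so link and deletion fall under the induction on
  \<open>card E\<close>.\<close>

lemma vertex_decomposable_matchings:
  assumes "finite E" "E \<subseteq> arcs D" "\<nexists>es. set es \<subseteq> E \<and> alternating_closed_trail D es"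
  shows "vertex_decomposable (matchings (tail D) (head D) E)"
  using assms
proof (induction "card E" arbitrary: E rule: less_induct)
  case less
  show ?case
  proof (cases "inj_on (tail D) E \<and> inj_on (head D) E")
    case True
    then have "matchings (tail D) (head D) E = Pow E"
      by (auto simp: matchings_def intro: inj_on_subset)
    then show ?thesis using less.prems(1) vertex_decomposable.simplex by metis
  next
    case False
    then obtain f where f: "f \<in> E"
      and shed: "facets (deletion (matchings (tail D) (head D) E) f) \<subseteq> facets (matchings (tail D) (head D) E)"
    proof (cases rule: ex_leaf_arc[OF less.prems False, case_names tail head])
      case (tail e f)
      then show ?thesis using that facets_deletion_matchings[of e E f "tail D" "head D"] by blast
    next
      \<comment> \<open>The leaf is now at the tail end, so heads and tails swap their
        roles.\<close>
      case (head e f)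
      then show ?thesis
        using that facets_deletion_matchings[of e E f "head D" "tail D"]
        by (metis matchings_commute)
    qed
    have IH: "vertex_decomposable (matchings (tail D) (head D) E')" if "E' \<subset> E" for E'
      using that less.prems psubset_card_mono[of E E'] finite_subset[of E' E]
      by (intro less.hyps) blast+
    have "{f} \<in> matchings (tail D) (head D) E" using f by (auto simp: matchings_def)
    moreover have "vertex_decomposable (link (matchings (tail D) (head D) E) f)"
      unfolding link_matchings[OF f] using f by (intro IH) auto
    moreover have "vertex_decomposable (deletion (matchings (tail D) (head D) E) f)"
      unfolding deletion_matchings using f by (intro IH) auto
    ultimately show ?thesis
      using vertex_decomposable.shed[OF simplicial_complex_matchings[OF less.prems(1)]] shed by metis
  qed
qed

section \<open>Directed linear forests in acyclic digraphs\<close>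

lemma arc_subgraph_simps [simp]:
  "verts (arc_subgraph D \<sigma>) = tail D ` \<sigma> \<union> head D ` \<sigma>" "arcs (arc_subgraph D \<sigma>) = \<sigma>"
  "tail (arc_subgraph D \<sigma>) = tail D" "head (arc_subgraph D \<sigma>) = head D"
  by (simp_all add: arc_subgraph_def)

lemma wf_digraph_arc_subgraph: "wf_digraph (arc_subgraph D \<sigma>)"
  by unfold_locales auto

section \<open>Directed cycles from closed arc lists\<close>

text \<open>The heads are the tails shifted cyclically by one position, so both maps are injective
  on the arcs and all in- and out-degrees are 1. A list of length 1 gives a loop.\<close>

lemma directed_cycle_arc_subgraph:
  assumes "as \<noteq> []" "distinct (map (tail D) as)"
    and succ: "\<And>i. i < length as \<Longrightarrow> head D (as ! i) = tail D (as ! (Suc i mod length as))"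
  shows "directed_cycle (arc_subgraph D (set as))"
proof -
  define n where "n = length as"
  let ?C = "arc_subgraph D (set as)"
  interpret C: wf_digraph ?C by (rule wf_digraph_arc_subgraph)
  have n: "n > 0" using assms(1) by (simp add: n_def)
  have inj: "inj_on (tail D) (set as)" using assms(2) by (simp add: distinct_map)
  have dist: "distinct as" using assms(2) by (simp add: distinct_map)
  have nth: "\<exists>i<n. a = as ! i" if "a \<in> set as" for a
    using that by (metis in_set_conv_nth n_def)
  have verts: "verts ?C = tail D ` set as"
  proof -
    have "head D a \<in> tail D ` set as" if "a \<in> set as" for a
    proof -
      obtain i where i: "i < n" "a = as ! i" using nth \<open>a \<in> set as\<close> by blast
      then show ?thesis using succ[of i] n by (auto simp: n_def)
    qed
    then show ?thesis by auto
  qed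
  have hd_inj: "a = b" if ab: "a \<in> set as" "b \<in> set as" "head D a = head D b" for a b
  proof -
    obtain i j where ij: "i < n" "a = as ! i" "j < n" "b = as ! j"
      using nth ab(1,2) by meson
    then have "tail D (as ! (Suc i mod n)) = tail D (as ! (Suc j mod n))"
      using succ[of i] succ[of j] ab(3) by (auto simp: n_def)
    then have "as ! (Suc i mod n) = as ! (Suc j mod n)"
      using inj n by (auto simp: n_def dest!: inj_onD)
    then have "Suc i mod n = Suc j mod n"
      using dist n nth_eq_iff_index_eq[OF dist] by (auto simp: n_def)
    then have "i = j" using ij by (auto simp: mod_Suc split: if_splits)
    then show ?thesis using ij by simp
  qed
  have fin: "fin_digraph ?C" by (intro C.fin_digraphI) auto
  have nomulti: "nomulti_digraph ?C"
    by unfold_locales (use inj in \<open>auto simp: arc_to_ends_def dest: inj_onD\<close>)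
  have deg: "in_degree ?C v = 1 \<and> out_degree ?C v = 1" if v: "v \<in> verts ?C" for v
  proof -
    obtain i where i: "i < n" "v = tail D (as ! i)"
      using v nth unfolding verts by blast
    have "out_arcs ?C v = {as ! i}"
      using i inj by (auto simp: out_arcs_def n_def dest: inj_onD)
    moreover
    \<comment> \<open>\<open>k\<close> is the cyclic predecessor of \<open>i\<close>; for
      \<open>i = 0\<close> it is the last position.\<close>
    define k where "k = (if i = 0 then n - 1 else i - 1)"
    have k: "k < n" "Suc k mod n = i" using i n by (auto simp: k_def)
    then have "head D (as ! k) = v" using succ[of k] i by (auto simp: n_def)
    then have "in_arcs ?C v = {as ! k}"
      using k hd_inj by (auto simp: in_arcs_def n_def)
    ultimately show ?thesis by (simp add: in_degree_def out_degree_def)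
  qed
  have reach: "tail D (as ! i) \<rightarrow>\<^sup>*\<^bsub>?C\<^esub> tail D (as ! ((i + k) mod n))" if "i < n" for i k
  proof (induction k)
    case 0
    then show ?case using that by (auto simp: verts n_def intro!: C.reachable_refl)
  next
    case (Suc k)
    have "(i + k) mod n < n" using n by simp
    then have "tail D (as ! ((i + k) mod n)) \<rightarrow>\<^bsub>?C\<^esub> tail D (as ! (Suc ((i + k) mod n) mod n))"
      using succ[of "(i + k) mod n"] by (auto simp: arcs_ends_conv n_def image_iff intro!: bexI[of _ "as ! ((i + k) mod n)"])
    moreover have "Suc ((i + k) mod n) mod n = (i + Suc k) mod n" by (simp add: mod_Suc_eq)
    ultimately show ?case using Suc.IH C.reachable_adj_trans by metis
  qed
  have "strongly_connected ?C"
    unfolding strongly_connected_def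
  proof (intro conjI ballI)
    show "verts ?C \<noteq> {}" using assms(1) by simp
    fix u v assume "u \<in> verts ?C" "v \<in> verts ?C"
    then obtain i j where ij: "i < n" "u = tail D (as ! i)" "j < n" "v = tail D (as ! j)"
      using nth unfolding verts by blast
    \<comment> \<open>Going from \<open>i\<close> to \<open>j\<close> through position 0 avoids a
      truncated difference \<open>j - i\<close>.\<close>
    then have "(i + (n - i + j)) mod n = j" by simp
    then show "u \<rightarrow>\<^sup>*\<^bsub>?C\<^esub> v" using reach[of i "n - i + j"] ij by simp
  qed
  then have "connected ?C"
    using C.reachable_mk_symmetricI by (simp add: connected_def strongly_connected_def)
  with fin nomulti deg show ?thesis by (auto simp: directed_cycle_def)
qed

section \<open>Directed paths as arc lists\<close>

definition walk_verts :: "('a, 'b) pre_digraph \<Rightarrow> 'b list \<Rightarrow> 'a list" where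
  "walk_verts D as = tail D (hd as) # map (head D) as"

text \<open>Lists are nonempty because \<open>hd []\<close> is unspecified; every vertex of an
  \<open>arc_subgraph\<close> is an end of an arc, so each of its components has an arc.\<close>

definition path_arcs :: "('a, 'b) pre_digraph \<Rightarrow> 'b list \<Rightarrow> bool" where
  "path_arcs D as \<longleftrightarrow> as \<noteq> [] \<and> successively (\<lambda>a b. head D a = tail D b) as \<and>
     distinct (walk_verts D as)"

text \<open>Entry 0 is the initial vertex; for \<open>i > 0\<close>, entry \<open>i\<close> is the
  head of arc \<open>i - 1\<close>, which is the tail of arc \<open>i\<close>.\<close>

lemma tail_conv_walk_verts:
  assumes "path_arcs D as" "i < length as"
  shows "tail D (as ! i) = walk_verts D as ! i"
  using assms
  by (cases i) (auto simp: path_arcs_def walk_verts_def hd_conv_nth successively_conv_nth)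

lemma set_walk_verts:
  assumes "path_arcs D as"
  shows "set (walk_verts D as) = verts (arc_subgraph D (set as))"
proof -
  have "tail D a \<in> set (walk_verts D as)" if a: "a \<in> set as" for a
  proof -
    obtain i where "i < length as" "as ! i = a" using a by (auto simp: in_set_conv_nth)
    moreover have "length as < length (walk_verts D as)" by (simp add: walk_verts_def)
    ultimately show ?thesis
      using tail_conv_walk_verts[OF assms, of i] by (metis less_trans nth_mem)
  qed
  then show ?thesis using assms by (auto simp: walk_verts_def path_arcs_def)
qed

text \<open>One more arc, from the last vertex back to the first, would close the path to a cycle. A
  cycle on the numbers up to \<open>n\<close> serves as the model, and its closing arc is
  deleted.\<close>

lemma directed_path_arc_subgraph:
  assumes "path_arcs D as"
  shows "directed_path (arc_subgraph D (set as))"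
proof -
  define n where "n = length as"
  \<comment> \<open>Arc \<open>i\<close> runs from \<open>i\<close> to \<open>i + 1\<close> modulo
    \<open>n + 1\<close>, so arc \<open>n\<close> is the closing one.\<close>
  define N :: "(nat, nat) pre_digraph" where
    "N = \<lparr>verts = {..n}, arcs = {..n}, tail = id, head = \<lambda>i. Suc i mod Suc n\<rparr>"
  have "arc_subgraph N (set [0..<Suc n]) = N"
    by (auto simp: arc_subgraph_def N_def)
  moreover have "directed_cycle (arc_subgraph N (set [0..<Suc n]))"
    by (rule directed_cycle_arc_subgraph) (auto simp: N_def nth_append simp del: upt_Suc)
  ultimately have cyc: "directed_cycle N" by simp
  define f where "f = \<lparr>iso_verts = (!) (walk_verts D as), iso_arcs = (!) as,
    iso_head = head D, iso_tail = tail D\<rparr>"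
  let ?P = "pre_digraph.del_arc N n"
  have P: "verts ?P = {..n}" "arcs ?P = {..<n}" "tail ?P = id" "head ?P = (\<lambda>i. Suc i mod Suc n)"
    by (auto simp: pre_digraph.del_arc_def N_def)
  have len: "length (walk_verts D as) = Suc n" by (simp add: walk_verts_def n_def)
  have dist: "distinct (walk_verts D as)" using assms by (simp add: path_arcs_def)
  then have "distinct as" by (auto simp: walk_verts_def distinct_map)
  have "pre_digraph.digraph_isomorphism ?P f"
    unfolding pre_digraph.digraph_isomorphism_def
  proof (intro conjI ballI)
    show "wf_digraph ?P" by unfold_locales (auto simp: P)
    show "inj_on (iso_verts f) (verts ?P)"
      using dist len by (auto simp: f_def P inj_on_def nth_eq_iff_index_eq)
    show "inj_on (iso_arcs f) (arcs ?P)"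
      using \<open>distinct as\<close> by (auto simp: f_def P inj_on_def nth_eq_iff_index_eq n_def[symmetric])
    fix a assume "a \<in> arcs ?P"
    then have a: "a < length as" by (auto simp: P n_def[symmetric])
    show "iso_verts f (tail ?P a) = iso_tail f (iso_arcs f a)"
      using tail_conv_walk_verts[OF assms a] by (simp add: f_def P)
    \<comment> \<open>Only arcs below \<open>n\<close> remain, so \<open>Suc a mod Suc n\<close>
      does not wrap around.\<close>
    show "iso_verts f (head ?P a) = iso_head f (iso_arcs f a)"
      using a by (simp add: f_def P walk_verts_def n_def[symmetric])
  qed
  moreover have "arc_subgraph D (set as) = app_iso f ?P"
  proof -
    have "set as = (!) as ` {..<n}" by (auto simp: set_conv_nth n_def)
    moreover have "set (walk_verts D as) = (!) (walk_verts D as) ` {..n}"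
      using len by (auto simp: set_conv_nth less_Suc_eq_le)
    ultimately show ?thesis
      using set_walk_verts[OF assms]
      by (auto simp: arc_subgraph_def app_iso_def f_def P)
  qed
  ultimately have "digraph_iso ?P (arc_subgraph D (set as))"
    unfolding digraph_iso_def by blast
  moreover have "n \<in> arcs N" by (simp add: N_def)
  ultimately show ?thesis using cyc unfolding directed_path_def by blast
qed

section \<open>Injectivity of tails and heads on paths and forests\<close>

text \<open>All degrees in a directed cycle are 1, so tails and heads are injective on its arcs;
  deleting an arc and renaming along an isomorphism preserve this.\<close>

lemma directed_path_inj_on:
  assumes "directed_path P"
  shows "wf_digraph P" "inj_on (tail P) (arcs P)" "inj_on (head P) (arcs P)"
proof -
  obtain C :: "(nat, nat) pre_digraph" and a f where C: "directed_cycle C"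
    and f: "pre_digraph.digraph_isomorphism (pre_digraph.del_arc C a) f"
    and P: "P = app_iso f (pre_digraph.del_arc C a)"
    using assms by (auto simp: directed_path_def digraph_iso_def)
  interpret C: fin_digraph C using C by (simp add: directed_cycle_def)
  let ?Q = "pre_digraph.del_arc C a"
  have Q: "verts ?Q = verts C" "arcs ?Q \<subseteq> arcs C" "tail ?Q = tail C" "head ?Q = head C"
    by (auto simp: C.del_arc_def)
  show "wf_digraph P"
    unfolding P using f by (intro wf_digraph.wf_digraphI_app_iso) (auto simp: pre_digraph.digraph_isomorphism_def)
  have deg: "card (in_arcs C v) = 1" "card (out_arcs C v) = 1" if "v \<in> verts C" for v
    using C that by (auto simp: directed_cycle_def in_degree_def out_degree_def)
  have tail_inj: "x = y" if "x \<in> arcs C" "y \<in> arcs C" "tail C x = tail C y" for x y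
  proof -
    obtain z where "out_arcs C (tail C x) = {z}"
      using deg(2)[of "tail C x"] \<open>x \<in> arcs C\<close> by (metis C.tail_in_verts card_1_singletonE)
    moreover have "x \<in> out_arcs C (tail C x)" "y \<in> out_arcs C (tail C x)"
      using that by (auto simp: out_arcs_def)
    ultimately show ?thesis by (metis singletonD)
  qed
  have head_inj: "x = y" if "x \<in> arcs C" "y \<in> arcs C" "head C x = head C y" for x y
  proof -
    obtain z where "in_arcs C (head C x) = {z}"
      using deg(1)[of "head C x"] \<open>x \<in> arcs C\<close> by (metis C.head_in_verts card_1_singletonE)
    moreover have "x \<in> in_arcs C (head C x)" "y \<in> in_arcs C (head C x)"
      using that by (auto simp: in_arcs_def)
    ultimately show ?thesis by (metis singletonD)
  qed
  show "inj_on (tail P) (arcs P)"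
  proof (rule inj_onI)
    fix x y assume "x \<in> arcs P" "y \<in> arcs P" and eq: "tail P x = tail P y"
    then obtain x' y' where xy: "x' \<in> arcs ?Q" "x = iso_arcs f x'" "y' \<in> arcs ?Q" "y = iso_arcs f y'"
      by (auto simp: P)
    then have "iso_verts f (tail C x') = iso_verts f (tail C y')"
      using eq f Q by (auto simp: P pre_digraph.digraph_isomorphism_def)
    then have "tail C x' = tail C y'"
      using f xy Q C.tail_in_verts by (metis pre_digraph.iso_verts_eq_iff subsetD)
    moreover have "x' \<in> arcs C" "y' \<in> arcs C" using xy Q by auto
    ultimately have "x' = y'"
      using tail_inj by blast
    then show "x = y" using xy by simp
  qed
  show "inj_on (head P) (arcs P)"
  proof (rule inj_onI)
    fix x y assume "x \<in> arcs P" "y \<in> arcs P" and eq: "head P x = head P y"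
    then obtain x' y' where xy: "x' \<in> arcs ?Q" "x = iso_arcs f x'" "y' \<in> arcs ?Q" "y = iso_arcs f y'"
      by (auto simp: P)
    then have "iso_verts f (head C x') = iso_verts f (head C y')"
      using eq f Q by (auto simp: P pre_digraph.digraph_isomorphism_def)
    then have "head C x' = head C y'"
      using f xy Q C.head_in_verts by (metis pre_digraph.iso_verts_eq_iff subsetD)
    moreover have "x' \<in> arcs C" "y' \<in> arcs C" using xy Q by auto
    ultimately have "x' = y'"
      using head_inj by blast
    then show "x = y" using xy by simp
  qed
qed

text \<open>Arcs with a common tail or head lie on paths through a common vertex, hence on the same
  path by disjointness, where injectivity is known.\<close>

lemma directed_linear_forest_inj_on:
  assumes "directed_linear_forest H"
  shows "inj_on (tail H) (arcs H)" "inj_on (head H) (arcs H)"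
proof -
  obtain \<P> where \<P>: "\<And>P. P \<in> \<P> \<Longrightarrow> directed_path P" "\<And>P. P \<in> \<P> \<Longrightarrow> compatible H P"
    and disj: "pairwise (\<lambda>P Q. verts P \<inter> verts Q = {}) \<P>"
    and U: "pre_digraph.Union H \<P> = H"
    using assms by (auto simp: directed_linear_forest_def)
  have arcs: "arcs H = (\<Union>P\<in>\<P>. arcs P)"
    using U by (metis pre_digraph.Union_def pre_digraph.select_convs(2))
  have same: "P = Q" if "P \<in> \<P>" "Q \<in> \<P>" "v \<in> verts P" "v \<in> verts Q" for P Q v
    using disj that by (auto simp: pairwise_def)
  have comp: "tail P = tail H" "head P = head H" if "P \<in> \<P>" for P
    using \<P>(2)[OF that] by (auto simp: compatible_def)
  show "inj_on (tail H) (arcs H)"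
  proof (rule inj_onI)
    fix x y assume "x \<in> arcs H" "y \<in> arcs H" and eq: "tail H x = tail H y"
    then obtain P Q where PQ: "P \<in> \<P>" "x \<in> arcs P" "Q \<in> \<P>" "y \<in> arcs Q" by (auto simp: arcs)
    then have "tail H x \<in> verts P" "tail H x \<in> verts Q"
      using \<P>(1) directed_path_inj_on(1) wf_digraph.tail_in_verts comp eq by metis+
    then have "P = Q" using same PQ by blast
    then show "x = y"
      using PQ eq comp directed_path_inj_on(2)[OF \<P>(1)] by (metis inj_onD)
  qed
  show "inj_on (head H) (arcs H)"
  proof (rule inj_onI)
    fix x y assume "x \<in> arcs H" "y \<in> arcs H" and eq: "head H x = head H y"
    then obtain P Q where PQ: "P \<in> \<P>" "x \<in> arcs P" "Q \<in> \<P>" "y \<in> arcs Q" by (auto simp: arcs)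
    then have "head H x \<in> verts P" "head H x \<in> verts Q"
      using \<P>(1) directed_path_inj_on(1) wf_digraph.head_in_verts comp eq by metis+
    then have "P = Q" using same PQ by blast
    then show "x = y"
      using PQ eq comp directed_path_inj_on(3)[OF \<P>(1)] by (metis inj_onD)
  qed
qed

section \<open>Decomposition into directed paths\<close>

text \<open>Otherwise every arc has a successor in \<sigma>, and following successors up to the
  first repetition closes a walk. Its distinct arcs have distinct tails by injectivity, so it is a
  directed cycle of \<open>D\<close>.\<close>

lemma ex_terminal_arc:
  assumes "wf_digraph D" "acyclic_digraph D" "finite \<sigma>" "\<sigma> \<subseteq> arcs D" "inj_on (tail D) \<sigma>" "\<sigma> \<noteq> {}"
  obtains a where "a \<in> \<sigma>" "\<And>b. b \<in> \<sigma> \<Longrightarrow> tail D b \<noteq> head D a"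
proof (rule ccontr)
  note terminal = that
  assume "\<not> thesis"
  then have "\<exists>b. b \<in> \<sigma> \<and> tail D b = head D a" if "a \<in> \<sigma>" for a
    using terminal[OF that] by blast
  moreover have "\<exists>a. a \<in> \<sigma>" using assms(6) by blast
  ultimately obtain e where e: "\<And>n. e n \<in> \<sigma>" "\<And>n. tail D (e (Suc n)) = head D (e n)"
    using dependent_nat_choice[of "\<lambda>_ x. x \<in> \<sigma>" "\<lambda>_ x y. tail D y = head D x"] by metis
  obtain i j where ij: "i < j" "e i = e j" "inj_on e {..<j}"
    using first_repetition[of \<sigma> e] assms(3) e(1) by blast
  define as where "as = map e [i..<j]"
  have sub: "set as \<subseteq> \<sigma>" using e(1) by (auto simp: as_def)
  have "inj_on e {i..<j}" using ij(3) by (rule inj_on_subset) auto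
  then have "distinct (map (tail D) as)"
    using inj_on_subset[OF assms(5) sub] by (subst distinct_map) (auto simp: as_def distinct_map)
  moreover have "head D (as ! k) = tail D (as ! (Suc k mod length as))" if "k < length as" for k
  proof (cases "Suc k = j - i")
    case True
    \<comment> \<open>The last arc is followed by \<open>e j = e i\<close>, the first arc of the
      list.\<close>
    then have "j = Suc (i + k)" by auto
    then show ?thesis using e(2)[of "i + k"] ij(2) by (simp add: as_def del: upt_Suc)
  next
    case False
    then have "Suc k < j - i" using that by (simp add: as_def)
    then show ?thesis using e(2)[of "i + k"] by (simp add: as_def)
  qed
  moreover have "as \<noteq> []" using ij by (simp add: as_def)
  ultimately have "directed_cycle (arc_subgraph D (set as))"
    by (intro directed_cycle_arc_subgraph)
  moreover have "subgraph (arc_subgraph D (set as)) D"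
    using assms(1,4) sub wf_digraph_arc_subgraph[of D "set as"]
    by (auto simp: subgraph_def compatible_def wf_digraph.wellformed subset_iff)
  ultimately show False using assms(2) by (auto simp: acyclic_digraph_def)
qed

text \<open>Arcs are added in an order in which the new arc can only extend a path at its end.\<close>

lemma ex_path_decomposition:
  assumes "wf_digraph D" "acyclic_digraph D" "finite \<sigma>" "\<sigma> \<subseteq> arcs D"
    "inj_on (tail D) \<sigma>" "inj_on (head D) \<sigma>"
  shows "\<exists>L. (\<forall>as\<in>L. path_arcs D as) \<and> (\<Union>as\<in>L. set as) = \<sigma> \<and>
    pairwise (\<lambda>as bs. set (walk_verts D as) \<inter> set (walk_verts D bs) = {}) L"
  using assms(3-)
proof (induction \<sigma> rule: finite_remove_induct)
  case empty
  show ?case by (rule exI[of _ "{}"]) auto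
next
  case (remove \<sigma>)
  obtain a where a: "a \<in> \<sigma>" "\<And>b. b \<in> \<sigma> \<Longrightarrow> tail D b \<noteq> head D a"
    using ex_terminal_arc[OF assms(1,2) remove(1)] remove by blast
  have "inj_on (tail D) (\<sigma> - {a})" "inj_on (head D) (\<sigma> - {a})"
    using remove.prems by (auto intro: inj_on_subset)
  moreover have "\<sigma> - {a} \<subseteq> arcs D" using remove.prems(1) by blast
  ultimately obtain L where "\<forall>as\<in>L. path_arcs D as"
    and U: "(\<Union>as\<in>L. set as) = \<sigma> - {a}"
    and disj: "pairwise (\<lambda>as bs. set (walk_verts D as) \<inter> set (walk_verts D bs) = {}) L"
    using remove.IH[OF a(1)] by meson
  then have L: "path_arcs D as" if "as \<in> L" for as using that by blast
  \<comment> \<open>No arc of \<sigma> starts at \<open>head D a\<close> by the choice of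
    \<open>a\<close>, and only \<open>a\<close> ends there by injectivity: the vertex is new to the
    remaining paths.\<close>
  have ha: "head D a \<notin> set (walk_verts D as)" if "as \<in> L" for as
  proof
    have asL: "path_arcs D as" using L that by blast
    assume "head D a \<in> set (walk_verts D as)"
    then obtain b where "b \<in> set as" "head D a = tail D b \<or> head D a = head D b"
      using set_walk_verts[OF asL] by auto
    moreover have "set as \<subseteq> \<sigma> - {a}" using U \<open>as \<in> L\<close> by blast
    ultimately show False
      using a inj_onD[OF remove.prems(3)] by (metis DiffE insertI1 subsetD)
  qed
  show ?case
  proof (cases "\<exists>as\<in>L. tail D a \<in> set (walk_verts D as)")
    case False
    \<comment> \<open>The choice of \<open>a\<close>, applied to \<open>a\<close> itself, shows that
      \<open>a\<close> is no loop.\<close>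
    have "path_arcs D [a]" using a by (auto simp: path_arcs_def walk_verts_def)
    moreover have "set (walk_verts D [a]) \<inter> set (walk_verts D as) = {}" if "as \<in> L" for as
      using False ha that by (auto simp: walk_verts_def[of D "[a]"])
    then have "pairwise (\<lambda>as bs. set (walk_verts D as) \<inter> set (walk_verts D bs) = {}) (insert [a] L)"
      using disj by (simp add: pairwise_insert Int_commute)
    ultimately show ?thesis
      using L U a(1) by (intro exI[of _ "insert [a] L"]) auto
  next
    case True
    then obtain as where as: "as \<in> L" "tail D a \<in> set (walk_verts D as)" by blast
    have asL: "path_arcs D as" using L as by blast
    have sub: "set as \<subseteq> \<sigma> - {a}" using U as(1) by blast
    \<comment> \<open>No arc of \<open>as\<close> starts at \<open>tail D a\<close>, so this vertex
      is the head of some arc of \<open>as\<close>. That arc is the last one, since a next arc would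
      start there.\<close>
    have nt: "tail D b \<noteq> tail D a" if "b \<in> set as" for b
      using that sub a(1) inj_onD[OF remove.prems(2)] by blast
    then obtain b where "b \<in> set as" "head D b = tail D a"
      using as(2) set_walk_verts[OF asL] by force
    then obtain i where i: "i < length as" "head D (as ! i) = tail D a"
      by (auto simp: in_set_conv_nth)
    have "Suc i = length as"
    proof (rule ccontr)
      assume "Suc i \<noteq> length as"
      then have "Suc i < length as" using i by simp
      then have "tail D (as ! Suc i) = tail D a"
        using asL i by (simp add: path_arcs_def successively_conv_nth)
      then show False using nt \<open>Suc i < length as\<close> by simp
    qed
    then have last: "head D (last as) = tail D a"
      using i by (metis diff_Suc_1 last_conv_nth list.size(3) not_less_zero)
    have wv: "walk_verts D (as @ [a]) = walk_verts D as @ [head D a]"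
      using asL by (simp add: walk_verts_def path_arcs_def)
    have "path_arcs D (as @ [a])"
      unfolding path_arcs_def wv
      using asL last ha[OF as(1)] by (auto simp: path_arcs_def successively_append_iff)
    moreover have "pairwise (\<lambda>as bs. set (walk_verts D as) \<inter> set (walk_verts D bs) = {})
        (insert (as @ [a]) (L - {as}))"
    proof -
      have "set (walk_verts D as) \<inter> set (walk_verts D bs) = {}" if "bs \<in> L - {as}" for bs
        using disj as(1) that by (auto simp: pairwise_def)
      moreover have "pairwise (\<lambda>as bs. set (walk_verts D as) \<inter> set (walk_verts D bs) = {}) (L - {as})"
        using disj by (rule pairwise_subset) auto
      ultimately show ?thesis
        using ha by (auto simp: pairwise_insert wv)
    qed
    moreover have "(\<Union>bs\<in>insert (as @ [a]) (L - {as}). set bs) = insert a (\<Union>bs\<in>L. set bs)"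
      using as(1) by auto
    then have "(\<Union>bs\<in>insert (as @ [a]) (L - {as}). set bs) = \<sigma>"
      using U a(1) by auto
    ultimately show ?thesis
      using L by (intro exI[of _ "insert (as @ [a]) (L - {as})"]) auto
  qed
qed

lemma directed_linear_forest_arc_subgraph:
  assumes "wf_digraph D" "acyclic_digraph D" "finite \<sigma>" "\<sigma> \<subseteq> arcs D"
    "inj_on (tail D) \<sigma>" "inj_on (head D) \<sigma>"
  shows "directed_linear_forest (arc_subgraph D \<sigma>)"
proof -
  obtain L where L: "\<And>as. as \<in> L \<Longrightarrow> path_arcs D as"
    and U: "(\<Union>as\<in>L. set as) = \<sigma>"
    and disj: "pairwise (\<lambda>as bs. set (walk_verts D as) \<inter> set (walk_verts D bs) = {}) L"
    using ex_path_decomposition[OF assms] by metis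
  let ?\<P> = "(\<lambda>as. arc_subgraph D (set as)) ` L"
  have "pairwise (\<lambda>P Q. verts P \<inter> verts Q = {}) ?\<P>"
  proof (rule pairwiseI)
    fix P Q assume "P \<in> ?\<P>" "Q \<in> ?\<P>" "P \<noteq> Q"
    \<comment> \<open>Distinct subgraphs come from distinct lists, so disjointness carries
      over.\<close>
    then obtain as bs where "as \<in> L" "P = arc_subgraph D (set as)"
      "bs \<in> L" "Q = arc_subgraph D (set bs)" "as \<noteq> bs" by blast
    then show "verts P \<inter> verts Q = {}"
      using disj set_walk_verts[OF L] unfolding pairwise_def by metis
  qed
  moreover have "pre_digraph.Union (arc_subgraph D \<sigma>) ?\<P> = arc_subgraph D \<sigma>"
    using U by (auto simp: pre_digraph.Union_def arc_subgraph_def)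
  ultimately show ?thesis
    unfolding directed_linear_forest_def
    using directed_path_arc_subgraph[OF L]
    by (intro exI[of _ ?\<P>]) (auto simp: compatible_def)
qed

text \<open>Disjoint directed paths have injective tails and heads. Conversely, acyclicity rules out
  the directed cycles, which have both injectivities but are no linear forests.\<close>

lemma Dlf_eq_matchings:
  assumes "fin_digraph D" "acyclic_digraph D"
  shows "Dlf D = matchings (tail D) (head D) (arcs D)"
proof -
  interpret fin_digraph D by fact
  have "directed_linear_forest (arc_subgraph D \<sigma>) \<longleftrightarrow> inj_on (tail D) \<sigma> \<and> inj_on (head D) \<sigma>"
    if "\<sigma> \<subseteq> arcs D" for \<sigma>
    using directed_linear_forest_inj_on[of "arc_subgraph D \<sigma>"]
      directed_linear_forest_arc_subgraph[of D \<sigma>] that assms(2) wf_digraph finite_subset[OF that]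
    by auto
  then show ?thesis by (auto simp: Dlf_def matchings_def)
qed

theorem theorem3p9:
  fixes D :: "('a, 'b) pre_digraph"
  assumes "fin_digraph D"
    and "acyclic_digraph D"
    and "\<not> (\<exists>es. alternating_closed_trail D es)"
  shows "vertex_decomposable (Dlf D)"
  unfolding Dlf_eq_matchings[OF assms(1,2)]
  using assms(1,3) by (intro vertex_decomposable_matchings) (auto simp: fin_digraph.finite_arcs)

end
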